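(* Let $I,J\subseteq\mathbb{R}$ be open intervals, let $y:I\to J$ and $g:J\to\mathbb{R}$ be infinitely differentiable functions, and let $f(x)=g(y(x))$ for $x\in I$. Consider the ordinary generating functions (formal power series in $z$) $$F(x,z)=\sum_{n\ge 0}\frac{f^{(n)}(x)}{n!}z^n,\qquad Y(x,z)=\sum_{n\ge 1}\frac{y^{(n)}(x)}{n!}z^n\qquad (x\in I),$$ $$G(u,z)=\sum_{n\ge 0}\frac{g^{(n)}(u)}{n!}z^n\qquad (u\in J).$$ Then for every $x\in I$, $$F(x,z)=G\bigl(y(x),\,Y(x,z)\bigr)$$ as formal power series in $z$, where the right-hand side is the formal power series $G(y(x),\cdot)=\sum_{n\ge 0}\frac{g^{(n)}(y(x))}{n!}(\cdot)^n$ with $Y(x,z)$ substituted for its formal variable.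
   Context: Here $h^{(n)}$ denotes the $n$-th derivative, with $h^{(0)}=h$. The series $Y(x,z)$ has zero constant term in $z$, so substituting it into a formal power series is well defined. *)

theory Defs
  imports "HOL-Analysis.Analysis" "HOL-Computational_Algebra.Formal_Power_Series"
begin

text \<open>
  Intended for an open set \<open>S\<close>: differentiability is two-sided at each point of \<open>S\<close>.
  For open \<open>S\<close>, the derivatives on \<open>S\<close> depend only on the values of \<open>h\<close> on \<open>S\<close>,
  so \<open>h\<close> being a total function is harmless.
\<close>

definition infinitely_differentiable_on :: "(real \<Rightarrow> real) \<Rightarrow> real set \<Rightarrow> bool" where
  "infinitely_differentiable_on h S \<longleftrightarrow>
     (\<forall>n. \<forall>x\<in>S. (deriv ^^ n) h field_differentiable (at x))"

definition deriv_ogf :: "(real \<Rightarrow> real) \<Rightarrow> real \<Rightarrow> real fps" where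
  "deriv_ogf h x = Abs_fps (\<lambda>n. (deriv ^^ n) h x / fact n)"

definition deriv_ogf_pos :: "(real \<Rightarrow> real) \<Rightarrow> real \<Rightarrow> real fps" where
  "deriv_ogf_pos h x = Abs_fps (\<lambda>n. if n = 0 then 0 else (deriv ^^ n) h x / fact n)"

end

theory Submission
  imports Defs
begin

unbundle no vec_syntax and fps_syntax

text \<open>
  The series \<open>H(x, z) = \<Sum>\<^sub>n h\<^sup>(\<^sup>n\<^sup>)(x) z\<^sup>n / n!\<close> is the unique family of formal power series that satisfies
  the transport equation \<open>\<partial>\<^sub>x H = \<partial>\<^sub>z H\<close> coefficientwise and has constant term \<open>h\<close>. So it suffices
  to check the transport equation for \<open>R\<^sub>g(x, z) = G(y(x), Y(x, z))\<close>. The formal chain rule gives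
  \<open>\<partial>\<^sub>z R\<^sub>g = R\<^sub>g\<^sub>' \<partial>\<^sub>z Y\<close>, which expresses the coefficient of \<open>z\<^sup>n\<^sup>+\<^sup>1\<close> in \<open>R\<^sub>g\<close> by coefficients of
  \<open>R\<^sub>g\<^sub>'\<close> of index at most \<open>n\<close>. Hence induction on the index, for all smooth \<open>g\<close> simultaneously,
  together with the product rule yields the claim.
\<close>

lemma infinitely_differentiable_on_deriv:
  assumes "infinitely_differentiable_on h S"
  shows "infinitely_differentiable_on (deriv h) S"
  unfolding infinitely_differentiable_on_def
proof (intro allI ballI)
  fix n x assume "x \<in> S"
  then have "(deriv ^^ Suc n) h field_differentiable at x"
    using assms unfolding infinitely_differentiable_on_def by blast
  then show "(deriv ^^ n) (deriv h) field_differentiable at x"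
    by (simp add: funpow_swap1)
qed

lemma fps_deriv_deriv_ogf: "fps_deriv (deriv_ogf h x) = deriv_ogf (deriv h) x"
  by (rule fps_ext) (simp add: deriv_ogf_def funpow_swap1 field_simps del: of_nat_Suc)

text \<open>Differentiation in z kills the constant term, the only place where the two series
  differ.\<close>

lemma fps_deriv_deriv_ogf_pos: "fps_deriv (deriv_ogf_pos h x) = deriv_ogf (deriv h) x"
  by (rule fps_ext)
    (simp add: deriv_ogf_def deriv_ogf_pos_def funpow_swap1 field_simps del: of_nat_Suc)

lemma infinitely_differentiable_on_imp_DERIV:
  assumes "infinitely_differentiable_on h S" "x \<in> S"
  shows "(h has_field_derivative deriv h x) (at x)"
proof -
  have "(deriv ^^ 0) h field_differentiable at x"
    using assms unfolding infinitely_differentiable_on_def by blast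
  then show ?thesis
    by (simp add: DERIV_deriv_iff_field_differentiable)
qed

text \<open>The transport equation for a smooth function: both sides are the derivative of order n+1
  at x, divided by n!.\<close>

lemma DERIV_deriv_ogf_nth:
  assumes "infinitely_differentiable_on h S" "x \<in> S"
  shows "((\<lambda>t. deriv_ogf h t $ n) has_field_derivative fps_deriv (deriv_ogf h x) $ n) (at x)"
proof -
  have "((deriv ^^ n) h has_field_derivative deriv ((deriv ^^ n) h) x) (at x)"
    using assms unfolding infinitely_differentiable_on_def
    by (simp add: DERIV_deriv_iff_field_differentiable)
  from DERIV_cdivide[OF this, of "fact n"] show ?thesis
    unfolding fps_deriv_deriv_ogf by (simp add: deriv_ogf_def funpow_swap1)
qed

text \<open>Coefficient n of a Cauchy product involves only indices up to n. Bounding k by n lets a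
  strong induction supply the hypotheses.\<close>

lemma DERIV_fps_mult_nth:
  fixes A B :: "real \<Rightarrow> real fps"
  assumes "\<And>k. k \<le> n \<Longrightarrow> ((\<lambda>t. A t $ k) has_field_derivative A' $ k) (at x)"
    and "\<And>k. k \<le> n \<Longrightarrow> ((\<lambda>t. B t $ k) has_field_derivative B' $ k) (at x)"
  shows "((\<lambda>t. (A t * B t) $ n) has_field_derivative (A x * B' + A' * B x) $ n) (at x)"
proof -
  have "((\<lambda>t. \<Sum>i=0..n. A t $ i * B t $ (n - i)) has_field_derivative
         (\<Sum>i=0..n. A x $ i * B' $ (n - i) + A' $ i * B x $ (n - i))) (at x)"
    by (intro DERIV_sum DERIV_mult' assms) auto
  then show ?thesis
    by (simp add: fps_mult_nth sum.distrib)
qed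

text \<open>Coefficientwise, the transport equation says that (n+1) times coefficient n+1 is the
  x-derivative of coefficient n, so the constant term determines all the others.\<close>

lemma deriv_ogf_unique:
  fixes H :: "real \<Rightarrow> real fps"
  assumes "open S"
    and h: "\<And>x. x \<in> S \<Longrightarrow> h x = H x $ 0"
    and H: "\<And>n x. x \<in> S \<Longrightarrow> ((\<lambda>t. H t $ n) has_field_derivative fps_deriv (H x) $ n) (at x)"
    and "x \<in> S"
  shows "deriv_ogf h x = H x"
proof -
  have "\<forall>x\<in>S. (deriv ^^ n) h x = fact n * H x $ n" for n
  proof (induction n)
    case 0
    then show ?case using h by simp
  next
    case (Suc n)
    show ?case
    proof
      fix x assume x: "x \<in> S"
      have "((\<lambda>t. fact n * H t $ n) has_field_derivative fact n * fps_deriv (H x) $ n) (at x)"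
        by (rule DERIV_cmult[OF H[OF x]])
      \<comment> \<open>The induction hypothesis holds on all of the open set \<open>S\<close>,
        hence near \<open>x\<close>, so it may be differentiated.\<close>
      then have "((deriv ^^ n) h has_field_derivative fact n * fps_deriv (H x) $ n) (at x)"
        by (rule has_field_derivative_transform_within_open[OF _ \<open>open S\<close> x]) (simp add: Suc)
      then show "(deriv ^^ Suc n) h x = fact (Suc n) * H x $ Suc n"
        by (simp add: DERIV_imp_deriv algebra_simps)
    qed
  qed
  with \<open>x \<in> S\<close> show ?thesis
    by (auto simp: deriv_ogf_def fps_eq_iff)
qed

lemma fps_deriv_compose_deriv_ogf:
  "fps_deriv (deriv_ogf g u oo deriv_ogf_pos y x) =
     (deriv_ogf (deriv g) u oo deriv_ogf_pos y x) * deriv_ogf (deriv y) x"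
proof -
  have "deriv_ogf_pos y x $ 0 = 0"
    by (simp add: deriv_ogf_pos_def)
  then show ?thesis
    by (simp add: fps_compose_deriv fps_deriv_deriv_ogf fps_deriv_deriv_ogf_pos)
qed

lemma DERIV_compose_deriv_ogf_nth:
  assumes y: "infinitely_differentiable_on y I" "y ` I \<subseteq> J" and x: "x \<in> I"
    and g: "infinitely_differentiable_on g J"
  shows "((\<lambda>t. (deriv_ogf g (y t) oo deriv_ogf_pos y t) $ n) has_field_derivative
           fps_deriv (deriv_ogf g (y x) oo deriv_ogf_pos y x) $ n) (at x)"
  using g
proof (induction n arbitrary: g rule: less_induct)
  case (less n)
  define R where "R g t = deriv_ogf g (y t) oo deriv_ogf_pos y t" for g t
  have R': "fps_deriv (R g t) = R (deriv g) t * deriv_ogf (deriv y) t" for g t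
    unfolding R_def by (rule fps_deriv_compose_deriv_ogf)
  have "((\<lambda>t. R g t $ n) has_field_derivative fps_deriv (R g x) $ n) (at x)"
  proof (cases n)
    case 0
    \<comment> \<open>At index 0 the claim is the ordinary chain rule for g(y(t)).\<close>
    have "(g has_field_derivative deriv g (y x)) (at (y x))"
      by (rule infinitely_differentiable_on_imp_DERIV[OF less.prems]) (use y x in auto)
    from DERIV_chain2[OF this infinitely_differentiable_on_imp_DERIV[OF y(1) x]]
    show ?thesis
      unfolding 0 R' by (simp add: R_def deriv_ogf_def)
  next
    case (Suc m)
    let ?D = "\<lambda>t. R (deriv g) t * deriv_ogf (deriv y) t"
    have "((\<lambda>t. R (deriv g) t $ k) has_field_derivative fps_deriv (R (deriv g) x) $ k) (at x)"
      if "k \<le> m" for k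
      unfolding R_def
      using less.IH[of k] infinitely_differentiable_on_deriv[OF less.prems] that Suc by simp
    then have "((\<lambda>t. ?D t $ m) has_field_derivative fps_deriv (?D x) $ m) (at x)"
      unfolding fps_deriv_mult
      by (intro DERIV_fps_mult_nth
          DERIV_deriv_ogf_nth[OF infinitely_differentiable_on_deriv[OF y(1)] x])
    \<comment> \<open>Coefficient m of a z-derivative is m+1 times coefficient m+1 of the series;
      dividing by m+1 on both sides gives the claim at index m+1.\<close>
    then have "((\<lambda>t. fps_deriv (R g t) $ m / of_nat (Suc m)) has_field_derivative
        fps_deriv (fps_deriv (R g x)) $ m / of_nat (Suc m)) (at x)"
      unfolding R' by (rule DERIV_cdivide)
    then show ?thesis
      unfolding Suc by (simp del: of_nat_Suc add: field_simps)
  qed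
  then show ?case
    by (simp only: R_def)
qed

theorem theorem3p1:
  fixes I J :: "real set" and y g f :: "real \<Rightarrow> real"
  assumes "open I" and "is_interval I"
    and "open J" and "is_interval J"
    and "y ` I \<subseteq> J"
    and "infinitely_differentiable_on y I"
    and "infinitely_differentiable_on g J"
    and "\<And>x. x \<in> I \<Longrightarrow> f x = g (y x)"
  shows "\<forall>x\<in>I. deriv_ogf f x = fps_compose (deriv_ogf g (y x)) (deriv_ogf_pos y x)"
proof
  fix x assume x: "x \<in> I"
  show "deriv_ogf f x = deriv_ogf g (y x) oo deriv_ogf_pos y x"
  proof (rule deriv_ogf_unique[OF \<open>open I\<close> _ _ x])
    show "f t = (deriv_ogf g (y t) oo deriv_ogf_pos y t) $ 0" if "t \<in> I" for t
      using assms(8)[OF that] by (simp add: deriv_ogf_def)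
  qed (rule DERIV_compose_deriv_ogf_nth[OF assms(6,5) _ assms(7)])
qed

end
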